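(* Let $f:\omega\to\omega$ satisfy $\gamma(f)<1$ and let $X\subseteq\omega$ be $1$-generic relative to $f$. Then $\gamma^X(f)<1$.
   Context: For $C\subseteq\omega$, $\rho_n(C)=|C\cap\{0,\dots,n-1\}|/n$ and $\underline{\rho}(C)=\liminf_n\rho_n(C)$. $\gamma(f)=\sup\{r:$ some total computable $g$ has $\underline{\rho}(\{n:g(n)=f(n)\})\ge r\}$, and $\gamma^X(f)$ is the same with ``$X$-computable'' in place of ``computable''. $X$ is $1$-generic relative to $f$ if for every $f$-c.e. set $S$ of finite binary strings, either some initial segment of $X$ lies in $S$, or some initial segment of $X$ has no extension in $S$. *)

theory Defs
  imports "HOL-Library.Extended_Real" "HOL-Library.Liminf_Limsup"
    "HOL-Library.Nat_Bijection" "HOL-Library.Sublist"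
begin

text \<open>Programs for Kleene's partial recursive functions, with one extra basic function
  (\<open>Oracle\<close>) that stands for the oracle.\<close>

datatype recf =
    Zero
  | Succ
  | Proj nat
  | Oracle
  | Comp recf "recf list"
  | Prec recf recf
  | Mn recf

text \<open>\<open>eval h p xs y\<close>: program \<open>p\<close> with oracle \<open>h\<close> halts on the arguments \<open>xs\<close> with value \<open>y\<close>.\<close>

inductive eval :: "(nat \<Rightarrow> nat) \<Rightarrow> recf \<Rightarrow> nat list \<Rightarrow> nat \<Rightarrow> bool" for h :: "nat \<Rightarrow> nat" where
  eval_Zero: "eval h Zero xs 0"
| eval_Succ: "eval h Succ [x] (Suc x)"
| eval_Proj: "i < length xs \<Longrightarrow> eval h (Proj i) xs (xs ! i)"
| eval_Oracle: "eval h Oracle [x] (h x)"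
| eval_Comp: "list_all2 (\<lambda>q y. eval h q xs y) qs ys \<Longrightarrow> eval h p ys z \<Longrightarrow> eval h (Comp p qs) xs z"
| eval_Prec_0: "eval h p xs y \<Longrightarrow> eval h (Prec p q) (0 # xs) y"
| eval_Prec_Suc: "eval h (Prec p q) (n # xs) r \<Longrightarrow> eval h q (n # r # xs) y \<Longrightarrow>
    eval h (Prec p q) (Suc n # xs) y"
| eval_Mn: "eval h p (n # xs) 0 \<Longrightarrow> (\<forall>i<n. \<exists>y. eval h p (i # xs) (Suc y)) \<Longrightarrow>
    eval h (Mn p) xs n"

fun oracle_free :: "recf \<Rightarrow> bool" where
  "oracle_free Zero \<longleftrightarrow> True"
| "oracle_free Succ \<longleftrightarrow> True"
| "oracle_free (Proj i) \<longleftrightarrow> True"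
| "oracle_free Oracle \<longleftrightarrow> False"
| "oracle_free (Comp p qs) \<longleftrightarrow> oracle_free p \<and> (\<forall>q \<in> set qs. oracle_free q)"
| "oracle_free (Prec p q) \<longleftrightarrow> oracle_free p \<and> oracle_free q"
| "oracle_free (Mn p) \<longleftrightarrow> oracle_free p"

definition computable_in :: "(nat \<Rightarrow> nat) \<Rightarrow> (nat \<Rightarrow> nat) \<Rightarrow> bool" where
  "computable_in h g \<longleftrightarrow> (\<exists>p. \<forall>n. eval h p [n] (g n))"

text \<open>The oracle \<open>h\<close> below is irrelevant, since \<open>p\<close> never queries it.\<close>

definition computable :: "(nat \<Rightarrow> nat) \<Rightarrow> bool" where
  "computable g \<longleftrightarrow> (\<exists>p. oracle_free p \<and> (\<forall>h n. eval h p [n] (g n)))"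

definition char_fun :: "nat set \<Rightarrow> nat \<Rightarrow> nat" where
  "char_fun X n = (if n \<in> X then 1 else 0)"

definition string_code :: "bool list \<Rightarrow> nat" where
  "string_code \<sigma> = list_encode (map of_bool \<sigma>)"

text \<open>A set of strings is c.e. in \<open>h\<close> if its set of codes is the domain of a partial
  \<open>h\<close>-computable function.\<close>

definition ce_in :: "(nat \<Rightarrow> nat) \<Rightarrow> bool list set \<Rightarrow> bool" where
  "ce_in h S \<longleftrightarrow> (\<exists>p. \<forall>\<sigma>. \<sigma> \<in> S \<longleftrightarrow> (\<exists>y. eval h p [string_code \<sigma>] y))"

definition initial_segment :: "nat set \<Rightarrow> nat \<Rightarrow> bool list" where
  "initial_segment X n = map (\<lambda>i. i \<in> X) [0..<n]"

definition one_generic_rel :: "(nat \<Rightarrow> nat) \<Rightarrow> nat set \<Rightarrow> bool" where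
  "one_generic_rel f X \<longleftrightarrow>
    (\<forall>S. ce_in f S \<longrightarrow>
      (\<exists>n. initial_segment X n \<in> S) \<or>
      (\<exists>n. \<forall>\<tau>. prefix (initial_segment X n) \<tau> \<longrightarrow> \<tau> \<notin> S))"

definition partial_density :: "nat \<Rightarrow> nat set \<Rightarrow> real" where
  "partial_density n C = real (card (C \<inter> {0..<n})) / real n"

definition lower_density :: "nat set \<Rightarrow> ereal" where
  "lower_density C = liminf (\<lambda>n. ereal (partial_density n C))"

definition gamma :: "(nat \<Rightarrow> nat) \<Rightarrow> real" where
  "gamma f = Sup {r. \<exists>g. computable g \<and> lower_density {n. g n = f n} \<ge> ereal r}"

definition gamma_in :: "nat set \<Rightarrow> (nat \<Rightarrow> nat) \<Rightarrow> real" where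
  "gamma_in X f =
    Sup {r. \<exists>g. computable_in (char_fun X) g \<and> lower_density {n. g n = f n} \<ge> ereal r}"

text \<open>The suprema above are taken over nonempty sets that are bounded by 1, so that the
  supremum on the reals has its intended meaning.\<close>

lemma lower_density_le_1: "lower_density C \<le> 1"
proof -
  have "partial_density n C \<le> 1" for n
    using card_mono[of "{0..<n}" "C \<inter> {0..<n}"]
    by (auto simp: partial_density_def divide_simps)
  then have "lower_density C \<le> liminf (\<lambda>n. 1 :: ereal)"
    unfolding lower_density_def by (intro Liminf_mono always_eventually) auto
  then show ?thesis
    by (simp add: Liminf_const)
qed

lemma lower_density_ge_0: "0 \<le> lower_density C"
  unfolding lower_density_def
  by (rule Liminf_bounded) (auto simp: partial_density_def)

lemma gamma_set_bdd:
  "bdd_above {r. \<exists>g. P g \<and> lower_density {n. g n = f n} \<ge> ereal r}"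
proof (rule bdd_aboveI[of _ 1])
  fix r assume "r \<in> {r. \<exists>g. P g \<and> lower_density {n. g n = f n} \<ge> ereal r}"
  then have "ereal r \<le> 1"
    using lower_density_le_1 order_trans by blast
  then show "r \<le> 1"
    by simp
qed

lemma computable_zero: "computable (\<lambda>_. 0)"
  unfolding computable_def by (intro exI[of _ Zero]) (auto intro: eval_Zero)

lemma computable_imp_computable_in: "computable g \<Longrightarrow> computable_in h g"
  unfolding computable_def computable_in_def by blast

lemma zero_in_gamma_set:
  "0 \<in> {r. \<exists>g. computable g \<and> lower_density {n. g n = f n} \<ge> ereal r}"
  "0 \<in> {r. \<exists>g. computable_in h g \<and> lower_density {n. g n = f n} \<ge> ereal r}"
  using computable_zero computable_imp_computable_in[OF computable_zero] lower_density_ge_0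
  by (auto simp: zero_ereal_def[symmetric])

end

theory Submission imports Defs begin

text \<open>Suppose a program \<open>p\<close> with oracle \<open>X\<close> computes a function that, from some \<open>m\<close>
  on, disagrees with \<open>f\<close> on at most \<open>n / N\<close> arguments below \<open>n\<close>. The strings on which
  \<open>p\<close> visibly violates this bound form an \<open>f\<close>-c.e. set that \<open>X\<close> does not meet, so by
  genericity some initial segment \<open>\<sigma>\<close> of \<open>X\<close> has no extension in it. Hence any extension of
  \<open>\<sigma>\<close> on which \<open>p\<close> converges below \<open>2 ^ j\<close> satisfies the bound, and such extensions can be
  found without an oracle. Using a single one of them on each dyadic block
  \<open>[2 ^ (j - 1), 2 ^ j)\<close> yields a computable function that disagrees with \<open>f\<close> on upper density at
  most \<open>4 / N\<close>. Thus \<open>1 - gamma f\<close> is at most four times \<open>1 - gamma_in X f\<close>.\<close>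

section \<open>Functions computed by programs\<close>

text \<open>The two cases of interest are \<open>H = UNIV\<close>, computability without an oracle, and \<open>H = {f}\<close>,
  computability in \<open>f\<close>; one set of closure lemmas serves both.\<close>

definition rec_fun :: "(nat \<Rightarrow> nat) set \<Rightarrow> nat \<Rightarrow> (nat list \<Rightarrow> nat) \<Rightarrow> bool" where
  "rec_fun H n F \<longleftrightarrow> (\<exists>p. (H = UNIV \<longrightarrow> oracle_free p) \<and>
    (\<forall>h\<in>H. \<forall>xs. length xs = n \<longrightarrow> eval h p xs (F xs)))"

definition rec_rel :: "(nat \<Rightarrow> nat) set \<Rightarrow> nat \<Rightarrow> (nat list \<Rightarrow> bool) \<Rightarrow> bool" where
  "rec_rel H n P \<longleftrightarrow> rec_fun H n (\<lambda>xs. of_bool (P xs))"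

text \<open>\<open>Comp\<close> takes a list of inner programs. Bundling them as one list-valued map
  lets a single composition rule cover every arity and every dropping or rearranging of
  arguments.\<close>

definition rec_args :: "(nat \<Rightarrow> nat) set \<Rightarrow> nat \<Rightarrow> nat \<Rightarrow> (nat list \<Rightarrow> nat list) \<Rightarrow> bool" where
  "rec_args H n m L \<longleftrightarrow> (\<forall>xs. length xs = n \<longrightarrow> length (L xs) = m) \<and>
    (\<forall>i<m. rec_fun H n (\<lambda>xs. L xs ! i))"

section \<open>Composition and argument lists\<close>

lemma rec_fun_cong:
  "rec_fun H n F \<Longrightarrow> (\<And>xs. length xs = n \<Longrightarrow> F xs = G xs) \<Longrightarrow> rec_fun H n G"
  unfolding rec_fun_def by metis

lemma rec_fun_comp:
  assumes "rec_fun H m F" "rec_args H n m L"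
  shows "rec_fun H n (\<lambda>xs. F (L xs))"
proof -
  from assms(1) obtain p where p: "H = UNIV \<longrightarrow> oracle_free p"
    "\<And>h xs. h \<in> H \<Longrightarrow> length xs = m \<Longrightarrow> eval h p xs (F xs)"
    unfolding rec_fun_def by blast
  from assms(2) have len: "\<And>xs. length xs = n \<Longrightarrow> length (L xs) = m"
    and "\<forall>i<m. \<exists>q. (H = UNIV \<longrightarrow> oracle_free q) \<and>
      (\<forall>h\<in>H. \<forall>xs. length xs = n \<longrightarrow> eval h q xs (L xs ! i))"
    unfolding rec_args_def rec_fun_def by blast+
  then obtain q where q: "\<And>i. i < m \<Longrightarrow> H = UNIV \<longrightarrow> oracle_free (q i)"
    "\<And>i h xs. i < m \<Longrightarrow> h \<in> H \<Longrightarrow> length xs = n \<Longrightarrow> eval h (q i) xs (L xs ! i)"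
    by metis
  show ?thesis
    unfolding rec_fun_def
  proof (intro exI[of _ "Comp p (map q [0..<m])"] conjI ballI allI impI)
    show "oracle_free (Comp p (map q [0..<m]))" if "H = UNIV"
      using p(1) q(1) that by auto
    fix h and xs :: "nat list" assume "h \<in> H" "length xs = n"
    then show "eval h (Comp p (map q [0..<m])) xs (F (L xs))"
      using p(2) q(2) len by (intro eval_Comp[where ys = "L xs"]) (auto simp: list_all2_conv_all_nth)
  qed
qed

lemma rec_rel_comp: "rec_rel H m P \<Longrightarrow> rec_args H n m L \<Longrightarrow> rec_rel H n (\<lambda>xs. P (L xs))"
  unfolding rec_rel_def by (rule rec_fun_comp)

lemma rec_args_id: "rec_args H n n (\<lambda>xs. xs)"
  unfolding rec_args_def rec_fun_def
  by (auto intro!: exI[of _ "Proj _"] eval_Proj)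

lemma rec_args_drop:
  assumes "rec_args H n m L"
  shows "rec_args H n (m - k) (\<lambda>xs. drop k (L xs))"
  unfolding rec_args_def
proof (intro conjI allI impI)
  show "length (drop k (L xs)) = m - k" if "length xs = n" for xs
    using assms that by (simp add: rec_args_def)
  fix i assume "i < m - k"
  with assms have nth: "rec_fun H n (\<lambda>xs. L xs ! (k + i))"
    and len: "\<And>xs. length xs = n \<Longrightarrow> k \<le> length (L xs)"
    by (auto simp: rec_args_def)
  show "rec_fun H n (\<lambda>xs. drop k (L xs) ! i)"
    by (rule rec_fun_cong[OF nth]) (use len in simp)
qed

lemma rec_args_Nil: "rec_args H n 0 (\<lambda>xs. [])"
  by (simp add: rec_args_def)

lemma rec_args_Cons:
  "rec_fun H n G \<Longrightarrow> rec_args H n m L \<Longrightarrow> rec_args H n (Suc m) (\<lambda>xs. G xs # L xs)"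
  unfolding rec_args_def
  by (auto simp: less_Suc_eq_0_disj)

lemma rec_args_map:
  "(\<And>q. q \<in> set qs \<Longrightarrow> rec_fun H n (G q)) \<Longrightarrow>
    rec_args H n (length qs) (\<lambda>xs. map (\<lambda>q. G q xs) qs)"
  by (simp add: rec_args_def)

lemma rec_fun_nth: "rec_args H n m L \<Longrightarrow> i < m \<Longrightarrow> rec_fun H n (\<lambda>xs. L xs ! i)"
  by (simp add: rec_args_def)

lemma rec_args_single: "rec_fun H n A \<Longrightarrow> rec_args H n (Suc 0) (\<lambda>xs. [A xs])"
  by (intro rec_args_Cons rec_args_Nil)

section \<open>Primitive recursion and arithmetic\<close>

lemma rec_fun_Suc:
  assumes "rec_fun H n A"
  shows "rec_fun H n (\<lambda>xs. Suc (A xs))"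
proof -
  have "rec_fun H (Suc 0) (\<lambda>ys. Suc (ys ! 0))"
    by (auto simp: rec_fun_def length_Suc_conv intro!: exI[of _ Succ] eval_Succ)
  from rec_fun_comp[OF this rec_args_single[OF assms]] show ?thesis by simp
qed

lemma rec_fun_const: "rec_fun H n (\<lambda>xs. k)"
proof (induction k)
  case 0
  then show ?case
    unfolding rec_fun_def by (auto intro!: exI[of _ Zero] eval_Zero)
qed (rule rec_fun_Suc)

lemma rec_fun_oracle:
  assumes "rec_fun {f} n A"
  shows "rec_fun {f} n (\<lambda>xs. f (A xs))"
proof -
  \<comment> \<open>The demand for an oracle-free program is vacuous for \<open>{f}\<close>, because
    there are at least two functions.\<close>
  have "(id :: nat \<Rightarrow> nat) \<noteq> Suc"
    by (metis id_apply n_not_Suc_n)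
  then have "{f} \<noteq> UNIV"
    by (metis UNIV_I singletonD)
  then have "rec_fun {f} (Suc 0) (\<lambda>ys. f (ys ! 0))"
    by (auto simp: rec_fun_def length_Suc_conv intro!: exI[of _ Oracle] eval_Oracle)
  from rec_fun_comp[OF this rec_args_single[OF assms]] show ?thesis by simp
qed

text \<open>\<open>Prec\<close> recurses on its first argument, so the bound \<open>B xs\<close> is
  put in front of \<open>xs\<close> by composition. The step program receives the counter and the
  previous value first, which moves the parameters up by two.\<close>

lemma rec_fun_rec_nat:
  assumes B: "rec_fun H n B" and P: "rec_fun H n P"
    and Q: "rec_fun H (n + 2) (\<lambda>ys. Q (ys ! 0) (ys ! 1) (drop 2 ys))"
  shows "rec_fun H n (\<lambda>xs. rec_nat (P xs) (\<lambda>i r. Q i r xs) (B xs))"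
proof -
  from P obtain p where p: "H = UNIV \<longrightarrow> oracle_free p"
    "\<And>h xs. h \<in> H \<Longrightarrow> length xs = n \<Longrightarrow> eval h p xs (P xs)"
    unfolding rec_fun_def by blast
  from Q obtain q where q: "H = UNIV \<longrightarrow> oracle_free q"
    "\<And>h xs. h \<in> H \<Longrightarrow> length xs = n + 2 \<Longrightarrow> eval h q xs (Q (xs ! 0) (xs ! 1) (drop 2 xs))"
    unfolding rec_fun_def by blast
  have *: "eval h (Prec p q) (b # xs) (rec_nat (P xs) (\<lambda>i r. Q i r xs) b)"
    if h: "h \<in> H" "length xs = n" for h b xs
  proof (induction b)
    case 0
    then show ?case using p(2) h by (auto intro: eval_Prec_0)
  next
    case (Suc b)
    then show ?case
      using q(2)[of h "b # rec_nat (P xs) (\<lambda>i r. Q i r xs) b # xs"] h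
      by (auto intro: eval_Prec_Suc)
  qed
  have "rec_fun H (Suc n) (\<lambda>ys. rec_nat (P (tl ys)) (\<lambda>i r. Q i r (tl ys)) (hd ys))"
    unfolding rec_fun_def using p(1) q(1) *
    by (intro exI[of _ "Prec p q"]) (auto simp: length_Suc_conv)
  from rec_fun_comp[OF this rec_args_Cons[OF B rec_args_id]] show ?thesis by simp
qed

lemma rec_fun_weaken2: "rec_fun H n F \<Longrightarrow> rec_fun H (n + 2) (\<lambda>ys. F (drop 2 ys))"
  using rec_fun_comp[OF _ rec_args_drop[OF rec_args_id], of H "n + 2" 2 F] by simp

lemma rec_fun_if:
  assumes "rec_rel H n P" "rec_fun H n A" "rec_fun H n B"
  shows "rec_fun H n (\<lambda>xs. if P xs then A xs else B xs)"
proof (rule rec_fun_cong)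
  \<comment> \<open>Recursion of depth 0 or 1 with a step that ignores counter and previous value is
    a case distinction.\<close>
  show "rec_fun H n (\<lambda>xs. rec_nat (B xs) (\<lambda>i r. A xs) (of_bool (P xs)))"
    using assms by (intro rec_fun_rec_nat rec_fun_weaken2) (auto simp: rec_rel_def)
qed simp

lemma rec_fun_pred:
  assumes "rec_fun H n A"
  shows "rec_fun H n (\<lambda>xs. A xs - 1)"
proof (rule rec_fun_cong)
  show "rec_fun H n (\<lambda>xs. rec_nat 0 (\<lambda>i r. i) (A xs))"
    using assms by (intro rec_fun_rec_nat rec_fun_const rec_fun_nth[OF rec_args_id]) auto
  show "rec_nat 0 (\<lambda>i r. i) (A xs) = A xs - 1" for xs
    by (cases "A xs") auto
qed

lemma rec_fun_diff:
  assumes "rec_fun H n A" "rec_fun H n B"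
  shows "rec_fun H n (\<lambda>xs. A xs - B xs)"
proof (rule rec_fun_cong)
  show "rec_fun H n (\<lambda>xs. rec_nat (A xs) (\<lambda>i r. r - 1) (B xs))"
    using assms by (intro rec_fun_rec_nat rec_fun_pred rec_fun_nth[OF rec_args_id]) auto
  have "rec_nat a (\<lambda>i r. r - 1) b = a - b" for a b :: nat
    by (induction b) auto
  then show "rec_nat (A xs) (\<lambda>i r. r - 1) (B xs) = A xs - B xs" for xs .
qed

lemma rec_fun_add:
  assumes "rec_fun H n A" "rec_fun H n B"
  shows "rec_fun H n (\<lambda>xs. A xs + B xs)"
proof (rule rec_fun_cong)
  show "rec_fun H n (\<lambda>xs. rec_nat (A xs) (\<lambda>i r. Suc r) (B xs))"
    using assms by (intro rec_fun_rec_nat rec_fun_Suc rec_fun_nth[OF rec_args_id]) auto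
  have "rec_nat a (\<lambda>i r. Suc r) b = a + b" for a b :: nat
    by (induction b) auto
  then show "rec_nat (A xs) (\<lambda>i r. Suc r) (B xs) = A xs + B xs" for xs .
qed

lemma rec_fun_mult_const:
  assumes "rec_fun H n A"
  shows "rec_fun H n (\<lambda>xs. k * A xs)"
proof (induction k)
  case 0
  then show ?case by (simp add: rec_fun_const)
next
  case (Suc k)
  then show ?case using rec_fun_add[OF assms Suc] by simp
qed

lemma rec_fun_power2:
  assumes "rec_fun H n A"
  shows "rec_fun H n (\<lambda>xs. 2 ^ A xs)"
proof (rule rec_fun_cong)
  show "rec_fun H n (\<lambda>xs. rec_nat 1 (\<lambda>i r. 2 * r) (A xs))"
    using assms
    by (intro rec_fun_rec_nat rec_fun_mult_const rec_fun_const rec_fun_nth[OF rec_args_id]) auto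
  have "rec_nat 1 (\<lambda>i r. 2 * r) b = 2 ^ b" for b :: nat
    by (induction b) auto
  then show "rec_nat 1 (\<lambda>i r. 2 * r) (A xs) = 2 ^ A xs" for xs .
qed

section \<open>Decidable relations, bounded quantification and minimization\<close>

lemma rec_rel_eq_0:
  assumes "rec_fun H n A"
  shows "rec_rel H n (\<lambda>xs. A xs = 0)"
  unfolding rec_rel_def
proof (rule rec_fun_cong)
  show "rec_fun H n (\<lambda>xs. 1 - A xs)"
    using assms by (intro rec_fun_diff rec_fun_const)
qed auto

lemma rec_rel_not: "rec_rel H n P \<Longrightarrow> rec_rel H n (\<lambda>xs. \<not> P xs)"
  using rec_rel_eq_0[of H n "\<lambda>xs. of_bool (P xs)"] by (simp add: rec_rel_def)

lemma rec_rel_conj: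
  assumes "rec_rel H n P" "rec_rel H n Q"
  shows "rec_rel H n (\<lambda>xs. P xs \<and> Q xs)"
  unfolding rec_rel_def
proof (rule rec_fun_cong)
  show "rec_fun H n (\<lambda>xs. if P xs then of_bool (Q xs) else 0)"
    using assms by (intro rec_fun_if rec_fun_const) (auto simp: rec_rel_def)
qed auto

lemma rec_rel_le:
  "rec_fun H n A \<Longrightarrow> rec_fun H n B \<Longrightarrow> rec_rel H n (\<lambda>xs. A xs \<le> B xs)"
  using rec_rel_eq_0[OF rec_fun_diff[of H n A B]] by simp

lemma rec_rel_less:
  "rec_fun H n A \<Longrightarrow> rec_fun H n B \<Longrightarrow> rec_rel H n (\<lambda>xs. A xs < B xs)"
  using rec_rel_le[OF rec_fun_Suc[of H n A]] by (simp add: Suc_le_eq)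

lemma rec_rel_eq:
  "rec_fun H n A \<Longrightarrow> rec_fun H n B \<Longrightarrow> rec_rel H n (\<lambda>xs. A xs = B xs)"
  using rec_rel_conj[OF rec_rel_le[of H n A B] rec_rel_le[of H n B A]]
  by (simp add: antisym_conv2 order_eq_iff)

lemma rec_rel_ball_list:
  "(\<And>q. q \<in> set qs \<Longrightarrow> rec_rel H n (P q)) \<Longrightarrow> rec_rel H n (\<lambda>xs. \<forall>q\<in>set qs. P q xs)"
proof (induction qs)
  case Nil
  then show ?case by (simp add: rec_rel_def rec_fun_const)
next
  case (Cons q qs)
  then show ?case using rec_rel_conj[of H n "P q" "\<lambda>xs. \<forall>q\<in>set qs. P q xs"] by simp
qed

text \<open>Adapts a relation in a bound variable and parameters to the argument layout of a
  recursion step, where position 1 holds the previous value.\<close>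

lemma rec_rel_skip_value:
  assumes "rec_rel H (Suc n) (\<lambda>ys. P (ys ! 0) (drop 1 ys))"
  shows "rec_rel H (n + 2) (\<lambda>ys. P (ys ! 0) (drop 2 ys))"
proof -
  have "rec_args H (n + 2) (Suc n) (\<lambda>ys. ys ! 0 # drop 2 ys)"
    using rec_args_drop[OF rec_args_id, of H "n + 2" 2]
    by (intro rec_args_Cons rec_fun_nth[OF rec_args_id]) auto
  from rec_rel_comp[OF assms this] show ?thesis by simp
qed

lemma rec_rel_all_less:
  assumes B: "rec_fun H n B" and P: "rec_rel H (Suc n) (\<lambda>ys. P (ys ! 0) (drop 1 ys))"
  shows "rec_rel H n (\<lambda>xs. \<forall>i<B xs. P i xs)"
  unfolding rec_rel_def
proof (rule rec_fun_cong)
  show "rec_fun H n (\<lambda>xs. rec_nat 1 (\<lambda>i r. if P i xs then r else 0) (B xs))"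
    by (intro rec_fun_rec_nat B rec_fun_if rec_rel_skip_value[OF P] rec_fun_const
        rec_fun_nth[OF rec_args_id]) auto
  have "rec_nat 1 (\<lambda>i r. if P i xs then r else 0) b = of_bool (\<forall>i<b. P i xs)" for b xs
    by (induction b) (auto simp: less_Suc_eq)
  then show "rec_nat 1 (\<lambda>i r. if P i xs then r else 0) (B xs) = of_bool (\<forall>i<B xs. P i xs)" for xs .
qed

lemma rec_fun_card_less:
  assumes B: "rec_fun H n B" and P: "rec_rel H (Suc n) (\<lambda>ys. P (ys ! 0) (drop 1 ys))"
  shows "rec_fun H n (\<lambda>xs. card {i. i < B xs \<and> P i xs})"
proof (rule rec_fun_cong)
  show "rec_fun H n (\<lambda>xs. rec_nat 0 (\<lambda>i r. if P i xs then Suc r else r) (B xs))"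
    by (intro rec_fun_rec_nat B rec_fun_if rec_rel_skip_value[OF P] rec_fun_const rec_fun_Suc
        rec_fun_nth[OF rec_args_id]) auto
  have "rec_nat 0 (\<lambda>i r. if P i xs then Suc r else r) b = card {i. i < b \<and> P i xs}" for b xs
  proof (induction b)
    case (Suc b)
    have "{i. i < Suc b \<and> P i xs} =
      (if P b xs then insert b {i. i < b \<and> P i xs} else {i. i < b \<and> P i xs})"
      by (auto simp: less_Suc_eq)
    then show ?case using Suc by simp
  qed simp
  then show "rec_nat 0 (\<lambda>i r. if P i xs then Suc r else r) (B xs) = card {i. i < B xs \<and> P i xs}" for xs .
qed

text \<open>\<open>Mn\<close> looks for a zero, so it is applied to the negation of
  \<open>P\<close>, whose value 1 before the first witness is the successor that
  \<open>eval_Mn\<close> asks for. Existence of a witness makes the search total.\<close>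

lemma rec_fun_Least:
  assumes P: "rec_rel H (Suc n) (\<lambda>ys. P (ys ! 0) (drop 1 ys))"
    and ex: "\<And>xs. length xs = n \<Longrightarrow> \<exists>i. P i xs"
  shows "rec_fun H n (\<lambda>xs. LEAST i. P i xs)"
proof -
  from rec_rel_not[OF P] obtain p where p: "H = UNIV \<longrightarrow> oracle_free p"
    "\<And>h xs. h \<in> H \<Longrightarrow> length xs = Suc n \<Longrightarrow> eval h p xs (of_bool (\<not> P (xs ! 0) (drop 1 xs)))"
    unfolding rec_fun_def rec_rel_def by blast
  have p': "eval h p (i # xs) (of_bool (\<not> P i xs))" if "h \<in> H" "length xs = n" for h i xs
    using p(2)[of h "i # xs"] that by simp
  have "eval h (Mn p) xs (LEAST i. P i xs)" if h: "h \<in> H" "length xs = n" for h xs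
  proof (rule eval_Mn)
    show "eval h p ((LEAST i. P i xs) # xs) 0"
      using p'[OF h, of "LEAST i. P i xs"] LeastI_ex[OF ex[OF h(2)]] by simp
    show "\<forall>i<LEAST i. P i xs. \<exists>y. eval h p (i # xs) (Suc y)"
    proof (intro allI impI)
      fix i assume "i < (LEAST i. P i xs)"
      then have "\<not> P i xs" by (rule not_less_Least)
      then have "eval h p (i # xs) (Suc 0)"
        using p'[OF h, of i] by simp
      then show "\<exists>y. eval h p (i # xs) (Suc y)" ..
    qed
  qed
  then show ?thesis
    unfolding rec_fun_def using p(1) by (intro exI[of _ "Mn p"]) auto
qed

section \<open>Codes of strings\<close>

lemma triangle_mono: "m \<le> n \<Longrightarrow> triangle m \<le> triangle n"
  unfolding triangle_def by (intro div_le_mono mult_le_mono) auto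

text \<open>Consecutive triangular numbers \<open>triangle (m + n)\<close> and
  \<open>triangle (Suc (m + n))\<close> differ by \<open>m + n + 1 > m\<close>, so the code of a
  pair determines its diagonal.\<close>

lemma Least_triangle: "(LEAST t. triangle (m + n) + m < triangle (Suc t)) = m + n"
proof (rule Least_equality)
  show "m + n \<le> t" if "triangle (m + n) + m < triangle (Suc t)" for t
  proof (rule ccontr)
    assume "\<not> m + n \<le> t"
    then have "triangle (Suc t) \<le> triangle (m + n)" by (intro triangle_mono) auto
    with that show False by simp
  qed
qed simp

text \<open>Expresses decoding through subtraction, triangular numbers and minimization only, all of
  which are already known to be computable.\<close>

lemma prod_decode_Least:
  defines "T \<equiv> \<lambda>z. LEAST t. z < triangle (Suc t)"
  shows "fst (prod_decode z) = z - triangle (T z)"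
    and "snd (prod_decode z) = T z - (z - triangle (T z))"
proof -
  obtain m n where mn: "prod_decode z = (m, n)" by (cases "prod_decode z")
  then have z: "z = triangle (m + n) + m"
    using prod_decode_inverse[of z] by (simp add: prod_encode_def)
  then have "T z = m + n"
    unfolding T_def by (simp only: Least_triangle)
  then show "fst (prod_decode z) = z - triangle (T z)"
    "snd (prod_decode z) = T z - (z - triangle (T z))"
    using mn z by simp_all
qed

lemma rec_fun_triangle:
  assumes "rec_fun H n A"
  shows "rec_fun H n (\<lambda>xs. triangle (A xs))"
proof (rule rec_fun_cong)
  show "rec_fun H n (\<lambda>xs. rec_nat 0 (\<lambda>i r. r + Suc i) (A xs))"
    using assms by (intro rec_fun_rec_nat rec_fun_add rec_fun_Suc rec_fun_const
        rec_fun_nth[OF rec_args_id]) auto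
  have "rec_nat 0 (\<lambda>i r. r + Suc i) b = triangle b" for b
    by (induction b) auto
  then show "rec_nat 0 (\<lambda>i r. r + Suc i) (A xs) = triangle (A xs)" for xs .
qed

lemma rec_fun_triangular_root:
  assumes "rec_fun H n A"
  shows "rec_fun H n (\<lambda>xs. LEAST t. A xs < triangle (Suc t))"
proof (rule rec_fun_Least)
  have "rec_fun H (Suc n) (\<lambda>ys. A (drop 1 ys))"
    using rec_fun_comp[OF assms] rec_args_drop[OF rec_args_id, of H "Suc n" 1] by simp
  then show "rec_rel H (Suc n) (\<lambda>ys. A (drop 1 ys) < triangle (Suc (ys ! 0)))"
    by (intro rec_rel_less rec_fun_triangle rec_fun_Suc rec_fun_nth[OF rec_args_id]) auto
  show "\<exists>t. A xs < triangle (Suc t)" for xs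
    by (intro exI[of _ "A xs"]) simp
qed

lemma rec_fun_fst_decode: "rec_fun H n A \<Longrightarrow> rec_fun H n (\<lambda>xs. fst (prod_decode (A xs)))"
  unfolding prod_decode_Least
  by (intro rec_fun_diff rec_fun_triangle rec_fun_triangular_root)

lemma rec_fun_snd_decode: "rec_fun H n A \<Longrightarrow> rec_fun H n (\<lambda>xs. snd (prod_decode (A xs)))"
  unfolding prod_decode_Least
  by (intro rec_fun_diff rec_fun_triangle rec_fun_triangular_root)

text \<open>Every number codes a binary string once nonzero list entries are read as 1. The value 0 means
  that the position lies outside the string; a bit is shifted up by one.\<close>

definition look :: "nat \<Rightarrow> nat \<Rightarrow> nat" where
  "look c x = (let d = rec_nat c (\<lambda>i d. snd (prod_decode (d - 1))) x in
    if d = 0 then 0 else if fst (prod_decode (d - 1)) = 0 then 1 else 2)"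

definition decode_string :: "nat \<Rightarrow> bool list" where
  "decode_string c = map (\<lambda>y. y \<noteq> 0) (list_decode c)"

lemma look_list_encode:
  "look (list_encode ys) x = (if x < length ys then if ys ! x = 0 then 1 else 2 else 0)"
proof -
  \<comment> \<open>The empty list has code 0, and unpacking keeps it at 0 since
    \<open>0 - 1 = 0\<close> decodes to \<open>(0, 0)\<close>. Hence reading past the end gives
    0.\<close>
  have "prod_decode 0 = (0, 0)"
    by (simp add: prod_decode_def prod_decode_aux.simps)
  then have "rec_nat (list_encode ys) (\<lambda>i d. snd (prod_decode (d - 1))) x = list_encode (drop x ys)"
  proof (induction x)
    case (Suc x)
    then show ?case
      by (cases "x < length ys") (auto simp: Cons_nth_drop_Suc[symmetric])
  qed simp
  then show ?thesis
    by (cases "x < length ys") (auto simp: look_def Cons_nth_drop_Suc[symmetric])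
qed

lemma look_string_code:
  "look (string_code \<sigma>) x = (if x < length \<sigma> then Suc (of_bool (\<sigma> ! x)) else 0)"
  by (simp add: string_code_def look_list_encode)

text \<open>A search ranges over all numbers, while genericity speaks of strings. This replaces any
  number by a genuine string code that answers every query alike.\<close>

lemma look_decode_string: "look (string_code (decode_string c)) = look c"
proof
  fix x
  show "look (string_code (decode_string c)) x = look c x"
    using look_list_encode[of "list_decode c" x]
    by (simp add: look_string_code decode_string_def)
qed

text \<open>Turns extension of a fixed string into a bounded check on codes. Bits read as 1 or 2 and
  missing positions as 0, so agreement also forces the second string to be long enough.\<close>

lemma prefix_iff_look:
  "prefix \<sigma> \<tau> \<longleftrightarrow> (\<forall>x<length \<sigma>. look (string_code \<tau>) x = look (string_code \<sigma>) x)"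
proof
  assume "prefix \<sigma> \<tau>"
  then show "\<forall>x<length \<sigma>. look (string_code \<tau>) x = look (string_code \<sigma>) x"
    by (auto simp: look_string_code prefix_def nth_append)
next
  assume *: "\<forall>x<length \<sigma>. look (string_code \<tau>) x = look (string_code \<sigma>) x"
  have bit: "x < length \<tau> \<and> \<tau> ! x = \<sigma> ! x" if "x < length \<sigma>" for x
    using *[rule_format, OF that] that
    by (cases "\<tau> ! x"; cases "\<sigma> ! x") (auto simp: look_string_code split: if_splits)
  then have "length \<sigma> \<le> length \<tau>"
    by (meson not_le order_less_irrefl)
  with bit have "take (length \<sigma>) \<tau> = \<sigma>"
    by (intro nth_equalityI) auto
  then show "prefix \<sigma> \<tau>"
    by (metis take_is_prefix)
qed

lemma rec_fun_look:
  assumes "rec_fun H n A" "rec_fun H n B"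
  shows "rec_fun H n (\<lambda>xs. look (A xs) (B xs))"
proof -
  have "rec_fun H n (\<lambda>xs. rec_nat (A xs) (\<lambda>i d. snd (prod_decode (d - 1))) (B xs))"
    using assms
    by (intro rec_fun_rec_nat rec_fun_snd_decode rec_fun_pred rec_fun_nth[OF rec_args_id]) auto
  then show ?thesis
    unfolding look_def Let_def
    by (intro rec_fun_if rec_rel_eq_0 rec_fun_const rec_fun_fst_decode rec_fun_pred)
qed

section \<open>Finite approximations to oracle computations\<close>

text \<open>Only minimization needs the stage \<open>s\<close>, which bounds the search; so \<open>approx s L p\<close> is
  primitive recursive. Results, like the answers of the partial oracle \<open>L\<close>, are 0 if undefined and
  otherwise shifted up by one. In the search for a zero, the state is 0 as long as the search runs,
  1 after it has met an undefined value, and \<open>i + 2\<close> once the zero \<open>i\<close> has been found.\<close>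

fun approx :: "nat \<Rightarrow> (nat \<Rightarrow> nat) \<Rightarrow> recf \<Rightarrow> nat list \<Rightarrow> nat" where
  "approx s L Zero xs = 1"
| "approx s L Succ xs = (if length xs = 1 then Suc (Suc (xs ! 0)) else 0)"
| "approx s L (Proj i) xs = (if i < length xs then Suc (xs ! i) else 0)"
| "approx s L Oracle xs = (if length xs = 1 then L (xs ! 0) else 0)"
| "approx s L (Comp p qs) xs = (if \<forall>q\<in>set qs. approx s L q xs \<noteq> 0
    then approx s L p (map (\<lambda>q. approx s L q xs - 1) qs) else 0)"
| "approx s L (Prec p q) xs = (if xs = [] then 0 else
    rec_nat (approx s L p (drop 1 xs))
      (\<lambda>i r. if r = 0 then 0 else approx s L q (i # (r - 1) # drop 1 xs)) (xs ! 0))"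
| "approx s L (Mn p) xs =
    rec_nat 0 (\<lambda>i r. if r = 0 then
      if approx s L p (i # xs) = 0 then 1
      else if approx s L p (i # xs) = 1 then Suc (Suc i) else 0 else r) s - 1"

lemma approx_Prec_Suc:
  "approx s L (Prec p q) (Suc n # xs) = (if approx s L (Prec p q) (n # xs) = 0 then 0
    else approx s L q (n # (approx s L (Prec p q) (n # xs) - 1) # xs))"
  by (simp cong: if_cong)

text \<open>The oracle enters only as the code of a finite string, so oracle programs can be
  simulated without an oracle. The arity stays general in the induction because \<open>Comp\<close>,
  \<open>Prec\<close> and \<open>Mn\<close> call subprograms with other numbers of
  arguments.\<close>

lemma rec_fun_approx_drop:
  "rec_fun H (a + 2) (\<lambda>xs. approx (xs ! 0) (look (xs ! 1)) p (drop 2 xs))"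
proof (induction p arbitrary: a)
  case Zero
  then show ?case by (simp add: rec_fun_const)
next
  case Succ
  show ?case
  proof (cases "a = 1")
    case True
    have "rec_fun H (a + 2) (\<lambda>xs. Suc (Suc (xs ! 2)))"
      using True by (intro rec_fun_Suc rec_fun_nth[OF rec_args_id]) auto
    then show ?thesis by (rule rec_fun_cong) (use True in simp)
  next
    case False
    show ?thesis by (rule rec_fun_cong[OF rec_fun_const[of _ _ 0]]) (use False in simp)
  qed
next
  case (Proj i)
  show ?case
  proof (cases "i < a")
    case True
    have "rec_fun H (a + 2) (\<lambda>xs. Suc (xs ! (2 + i)))"
      using True by (intro rec_fun_Suc rec_fun_nth[OF rec_args_id]) auto
    then show ?thesis by (rule rec_fun_cong) (use True in simp)
  next
    case False
    show ?thesis by (rule rec_fun_cong[OF rec_fun_const[of _ _ 0]]) (use False in simp)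
  qed
next
  case Oracle
  show ?case
  proof (cases "a = 1")
    case True
    have "rec_fun H (a + 2) (\<lambda>xs. look (xs ! 1) (xs ! 2))"
      using True by (intro rec_fun_look rec_fun_nth[OF rec_args_id]) auto
    then show ?thesis by (rule rec_fun_cong) (use True in simp)
  next
    case False
    show ?thesis by (rule rec_fun_cong[OF rec_fun_const[of _ _ 0]]) (use False in simp)
  qed
next
  case (Comp p qs)
  have "rec_args H (a + 2) (Suc (Suc (length qs)))
    (\<lambda>xs. xs ! 0 # xs ! 1 # map (\<lambda>q. approx (xs ! 0) (look (xs ! 1)) q (drop 2 xs) - 1) qs)"
    by (intro rec_args_Cons rec_args_map rec_fun_pred Comp(2) rec_fun_nth[OF rec_args_id]) auto
  from rec_fun_comp[OF Comp(1)[of "length qs", simplified] this]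
  have "rec_fun H (a + 2) (\<lambda>xs. approx (xs ! 0) (look (xs ! 1)) p
      (map (\<lambda>q. approx (xs ! 0) (look (xs ! 1)) q (drop 2 xs) - 1) qs))"
    by simp
  moreover have "rec_rel H (a + 2)
      (\<lambda>xs. \<forall>q\<in>set qs. approx (xs ! 0) (look (xs ! 1)) q (drop 2 xs) \<noteq> 0)"
    by (intro rec_rel_ball_list rec_rel_not rec_rel_eq_0 Comp(2))
  ultimately show ?case
    unfolding approx.simps by (intro rec_fun_if rec_fun_const)
next
  case (Prec p q)
  show ?case
  proof (cases a)
    case 0
    show ?thesis by (rule rec_fun_cong[OF rec_fun_const[of _ _ 0]]) (use 0 in simp)
  next
    case (Suc b)
    let ?n = "a + 2"
    \<comment> \<open>Positions 0, 1 and 2 hold the stage, the oracle code and the recursion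
      argument; the parameters start at 3.\<close>
    have d: "rec_args H ?n b (drop 3)"
      using rec_args_drop[OF rec_args_id, of H ?n 3] Suc by simp
    have P: "rec_fun H ?n (\<lambda>xs. approx (xs ! 0) (look (xs ! 1)) p (drop 3 xs))"
    proof -
      have "rec_args H ?n (Suc (Suc b)) (\<lambda>xs. xs ! 0 # xs ! 1 # drop 3 xs)"
        using d by (intro rec_args_Cons rec_fun_nth[OF rec_args_id]) auto
      from rec_fun_comp[OF Prec(1)[of b, simplified] this] show ?thesis by simp
    qed
    have Q: "rec_fun H (?n + 2) (\<lambda>ys. approx (drop 2 ys ! 0) (look (drop 2 ys ! 1)) q
        (ys ! 0 # (ys ! 1 - 1) # drop 3 (drop 2 ys)))"
    proof -
      have "rec_args H (?n + 2) b (\<lambda>ys. drop 3 (drop 2 ys))"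
        using rec_args_drop[OF rec_args_drop[OF rec_args_id], of H "?n + 2" 3 2] Suc by simp
      then have "rec_args H (?n + 2) (Suc (Suc (Suc (Suc b)))) (\<lambda>ys. drop 2 ys ! 0 # drop 2 ys ! 1 #
          ys ! 0 # (ys ! 1 - 1) # drop 3 (drop 2 ys))"
        by (intro rec_args_Cons rec_fun_pred rec_fun_nth[OF rec_args_id]
            rec_fun_nth[OF rec_args_drop[OF rec_args_id]]) auto
      from rec_fun_comp[OF Prec(2)[of "Suc (Suc b)", simplified] this] show ?thesis by simp
    qed
    have "rec_fun H ?n (\<lambda>xs. rec_nat (approx (xs ! 0) (look (xs ! 1)) p (drop 3 xs))
      (\<lambda>i r. if r = 0 then 0
        else approx (xs ! 0) (look (xs ! 1)) q (i # (r - 1) # drop 3 xs)) (xs ! 2))"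
      using Suc by (intro rec_fun_rec_nat P Q rec_fun_if rec_rel_eq_0 rec_fun_const
          rec_fun_nth[OF rec_args_id]) auto
    then show ?thesis
      by (rule rec_fun_cong) (use Suc in \<open>auto simp: numeral_3_eq_3 cong: if_cong\<close>)
  qed
next
  case (Mn p)
  have "rec_args H (a + 2 + 2) a (\<lambda>ys. drop 2 (drop 2 ys))"
    using rec_args_drop[OF rec_args_drop[OF rec_args_id], of H "a + 2 + 2" 2 2] by simp
  then have "rec_args H (a + 2 + 2) (Suc (Suc (Suc a))) (\<lambda>ys. drop 2 ys ! 0 # drop 2 ys ! 1 #
      ys ! 0 # drop 2 (drop 2 ys))"
    by (intro rec_args_Cons rec_fun_nth[OF rec_args_id]
        rec_fun_nth[OF rec_args_drop[OF rec_args_id]]) auto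
  from rec_fun_comp[OF Mn(1)[of "Suc a", simplified] this]
  have P: "rec_fun H (a + 2 + 2) (\<lambda>ys. approx (drop 2 ys ! 0) (look (drop 2 ys ! 1)) p
      (ys ! 0 # drop 2 (drop 2 ys)))"
    by simp
  have i: "rec_fun H (a + 2 + 2) (\<lambda>ys. ys ! 0)" and r: "rec_fun H (a + 2 + 2) (\<lambda>ys. ys ! 1)"
    and s: "rec_fun H (a + 2) (\<lambda>xs. xs ! 0)"
    by (intro rec_fun_nth[OF rec_args_id]; simp)+
  show ?case
    unfolding approx.simps
    by (rule rec_fun_pred, rule rec_fun_rec_nat[OF s rec_fun_const])
      (intro rec_fun_if rec_rel_eq rec_fun_Suc rec_fun_const P i r)
qed

lemma rec_fun_approx:
  assumes "rec_fun H n A" "rec_fun H n B" "rec_fun H n C"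
  shows "rec_fun H n (\<lambda>xs. approx (A xs) (look (B xs)) p [C xs])"
proof -
  have "rec_args H n (Suc (Suc (Suc 0))) (\<lambda>xs. [A xs, B xs, C xs])"
    using assms by (intro rec_args_Cons rec_args_Nil)
  from rec_fun_comp[OF rec_fun_approx_drop[of H 1 p, simplified] this]
  show ?thesis by simp
qed

text \<open>Soundness: the partial oracle must be right only where it is defined, so every value
  found from finite information is a true value.\<close>

lemma eval_approx:
  assumes L: "\<And>x y. L x = Suc y \<Longrightarrow> h x = y"
  shows "approx s L p xs = Suc v \<Longrightarrow> eval h p xs v"
proof (induction p arbitrary: xs v)
  case Zero
  then show ?case by (simp add: eval_Zero)
next
  case Succ
  then show ?case by (auto simp: length_Suc_conv split: if_splits intro: eval_Succ)
next
  case (Proj i)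
  then show ?case by (auto split: if_splits intro: eval_Proj)
next
  case Oracle
  then show ?case
    using L by (auto simp: length_Suc_conv split: if_splits) (metis eval_Oracle)
next
  case (Comp p qs)
  let ?ys = "map (\<lambda>q. approx s L q xs - 1) qs"
  have def: "\<forall>q\<in>set qs. approx s L q xs \<noteq> 0" and v: "approx s L p ?ys = Suc v"
    using Comp.prems by (auto split: if_splits)
  have "eval h q xs (approx s L q xs - 1)" if q: "q \<in> set qs" for q
  proof -
    obtain y where "approx s L q xs = Suc y"
      using def q by (cases "approx s L q xs") auto
    with Comp(2)[OF q] show ?thesis by simp
  qed
  then have "list_all2 (\<lambda>q y. eval h q xs y) qs ?ys"
    by (simp add: list_all2_conv_all_nth)
  with Comp(1)[OF v] show ?case by (rule eval_Comp[rotated])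
next
  case (Prec p q)
  then obtain n ys where xs: "xs = n # ys"
    by (cases xs) auto
  have "approx s L (Prec p q) (n # ys) = Suc v \<Longrightarrow> eval h (Prec p q) (n # ys) v"
  proof (induction n arbitrary: v)
    case 0
    then show ?case using Prec(1) by (auto intro: eval_Prec_0)
  next
    case (Suc n)
    show ?case
    proof (cases "approx s L (Prec p q) (n # ys)")
      case 0
      with Suc.prems show ?thesis unfolding approx_Prec_Suc by simp
    next
      case r: (Suc r)
      with Suc.prems have "approx s L q (n # r # ys) = Suc v"
        unfolding approx_Prec_Suc by simp
      with Suc.IH[OF r] Prec(2) show ?thesis by (blast intro: eval_Prec_Suc)
    qed
  qed
  then show ?case using Prec.prems unfolding xs .
next
  case (Mn p)
  let ?st = "\<lambda>s'. rec_nat 0 (\<lambda>i r. if r = 0 then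
      if approx s L p (i # xs) = 0 then 1
      else if approx s L p (i # xs) = 1 then Suc (Suc i) else 0 else r) s'"
  \<comment> \<open>Invariant of the search: \<open>1 < approx\<close> says defined with a nonzero
    value. Nothing is claimed for state 1, which the result turns into 0.\<close>
  have "(?st t = 0 \<longrightarrow> (\<forall>i<t. 1 < approx s L p (i # xs))) \<and>
    (\<forall>n. ?st t = Suc (Suc n) \<longrightarrow>
      approx s L p (n # xs) = 1 \<and> (\<forall>i<n. 1 < approx s L p (i # xs)))" for t
  proof (induction t)
    case (Suc t)
    show ?case
    proof (cases "?st t = 0")
      case True
      with Suc show ?thesis
        by (auto simp: less_Suc_eq)
    next
      case False
      with Suc show ?thesis by simp
    qed
  qed simp
  moreover have "?st s = Suc (Suc v)"
    using Mn.prems by simp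
  ultimately have v: "approx s L p (v # xs) = 1" "\<forall>i<v. 1 < approx s L p (i # xs)"
    by blast+
  show ?case
  proof (rule eval_Mn)
    show "eval h p (v # xs) 0" using Mn.IH v(1) by simp
    show "\<forall>i<v. \<exists>y. eval h p (i # xs) (Suc y)"
    proof (intro allI impI)
      fix i assume "i < v"
      with v(2) obtain y where "approx s L p (i # xs) = Suc (Suc y)"
        by (metis One_nat_def less_imp_Suc_add add_Suc)
      with Mn.IH show "\<exists>y. eval h p (i # xs) (Suc y)" by blast
    qed
  qed
qed

text \<open>Completeness, with \<open>t\<close> as both stage and length of the known part of the
  oracle. Asking for all late \<open>t\<close> lets finitely many subcomputations share a stage
  without a monotonicity argument.\<close>

lemma eventually_approx:
  "eval h p xs v \<Longrightarrow>
    eventually (\<lambda>t. approx t (\<lambda>x. if x < t then Suc (h x) else 0) p xs = Suc v) sequentially"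
proof (induction rule: eval.induct)
  case (eval_Oracle x)
  show ?case
    using eventually_gt_at_top[of x] by eventually_elim simp
next
  case (eval_Comp xs qs ys p z)
  let ?L = "\<lambda>t x. if x < t then Suc (h x) else 0"
  have len: "length qs = length ys"
    using eval_Comp by (auto dest: list_all2_lengthD)
  have "eventually (\<lambda>t. \<forall>i\<in>{..<length qs}. approx t (?L t) (qs ! i) xs = Suc (ys ! i)) sequentially"
    using eval_Comp by (intro eventually_ball_finite) (auto simp: list_all2_conv_all_nth)
  with eval_Comp.IH(2) show ?case
  proof eventually_elim
    case (elim t)
    then have "map (\<lambda>q. approx t (?L t) q xs - 1) qs = ys"
      using len by (intro nth_equalityI) auto
    moreover have "\<forall>q\<in>set qs. approx t (?L t) q xs \<noteq> 0"
      using elim by (auto simp: in_set_conv_nth)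
    ultimately show ?case using elim by simp
  qed
next
  case (eval_Prec_Suc p q n xs r y)
  from eval_Prec_Suc.IH show ?case
    unfolding approx_Prec_Suc by eventually_elim simp
next
  case (eval_Mn p n xs)
  let ?L = "\<lambda>t x. if x < t then Suc (h x) else 0"
  have "eventually (\<lambda>t. \<forall>i\<in>{..<n}. 1 < approx t (?L t) p (i # xs)) sequentially"
  proof (intro eventually_ball_finite ballI)
    fix i assume "i \<in> {..<n}"
    with eval_Mn obtain y where
      "eventually (\<lambda>t. approx t (?L t) p (i # xs) = Suc (Suc y)) sequentially"
      by blast
    then show "eventually (\<lambda>t. 1 < approx t (?L t) p (i # xs)) sequentially"
      by eventually_elim simp
  qed simp
  \<comment> \<open>The search at stage \<open>t\<close> tests only indices below \<open>t\<close>,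
    so reaching the zero \<open>n\<close> requires \<open>t > n\<close>.\<close>
  with eval_Mn.IH(1) show ?case
    using eventually_gt_at_top[of n]
  proof eventually_elim
    case (elim t)
    let ?st = "\<lambda>s'. rec_nat 0 (\<lambda>i r. if r = 0 then
      if approx t (?L t) p (i # xs) = 0 then 1
      else if approx t (?L t) p (i # xs) = 1 then Suc (Suc i) else 0 else r) s'"
    have "m \<le> n \<Longrightarrow> ?st m = 0" for m
    proof (induction m)
      case (Suc m)
      then have "1 < approx t (?L t) p (m # xs)" using elim by simp
      with Suc show ?case by simp
    qed simp
    \<comment> \<open>After index \<open>n\<close> the state is nonzero and no longer
      changes.\<close>
    then have "?st (Suc n + k) = Suc (Suc n)" for k
      using elim by (induction k) auto
    from this[of "t - Suc n"] have "?st t = Suc (Suc n)"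
      using elim by simp
    then show ?case unfolding approx.simps by simp
  qed
qed auto

text \<open>At all late stages the function \<open>approx\<close> returns both values.\<close>

lemma eval_det: "eval h p xs y \<Longrightarrow> eval h p xs z \<Longrightarrow> y = z"
proof (drule eventually_approx, drule eventually_approx)
  let ?a = "\<lambda>t. approx t (\<lambda>x. if x < t then Suc (h x) else 0) p xs"
  assume "eventually (\<lambda>t. ?a t = Suc y) sequentially" "eventually (\<lambda>t. ?a t = Suc z) sequentially"
  then have "eventually (\<lambda>t. y = z) sequentially"
    by eventually_elim simp
  then show ?thesis by simp
qed

text \<open>Search for a witness with \<open>Mn\<close> applied to the negation of \<open>R\<close>.
  That a halting search has found a witness uses determinism of evaluation.\<close>

lemma ce_in_ex:
  assumes "rec_rel {f} 2 (\<lambda>xs. R (xs ! 0) (xs ! 1))"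
  shows "ce_in f {\<sigma>. \<exists>w. R w (string_code \<sigma>)}"
proof -
  from rec_rel_not[OF assms] obtain p where
    p: "\<And>xs. length xs = 2 \<Longrightarrow> eval f p xs (of_bool (\<not> R (xs ! 0) (xs ! 1)))"
    unfolding rec_rel_def rec_fun_def by blast
  have p': "eval f p [w, c] (of_bool (\<not> R w c))" for w c
    using p[of "[w, c]"] by simp
  have "(\<exists>w. R w c) \<longleftrightarrow> (\<exists>y. eval f (Mn p) [c] y)" for c
  proof
    assume ex: "\<exists>w. R w c"
    have "eval f (Mn p) [c] (LEAST w. R w c)"
    proof (rule eval_Mn)
      show "eval f p [LEAST w. R w c, c] 0"
        using p'[of "LEAST w. R w c" c] LeastI_ex[OF ex] by simp
      show "\<forall>i<LEAST w. R w c. \<exists>y. eval f p [i, c] (Suc y)"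
      proof (intro allI impI)
        fix i assume "i < (LEAST w. R w c)"
        then have "\<not> R i c" by (rule not_less_Least)
        then have "eval f p [i, c] (Suc 0)" using p'[of i c] by simp
        then show "\<exists>y. eval f p [i, c] (Suc y)" ..
      qed
    qed
    then show "\<exists>y. eval f (Mn p) [c] y" ..
  next
    assume "\<exists>y. eval f (Mn p) [c] y"
    then obtain y where "eval f p [y, c] 0" by (auto elim: eval.cases)
    with p'[of y c] eval_det have "of_bool (\<not> R y c) = (0::nat)" by blast
    then show "\<exists>w. R w c" by auto
  qed
  then show ?thesis unfolding ce_in_def by blast
qed

section \<open>Density of agreement\<close>

lemma card_agree_disagree:
  "card ({k. g k = f k} \<inter> {0..<n}) + card {k. k < n \<and> g k \<noteq> f k} = n"
proof -
  have "card (({k. g k = f k} \<inter> {0..<n}) \<union> {k. k < n \<and> g k \<noteq> f k}) =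
    card ({k. g k = f k} \<inter> {0..<n}) + card {k. k < n \<and> g k \<noteq> f k}"
    by (rule card_Un_disjoint) auto
  moreover have "({k. g k = f k} \<inter> {0..<n}) \<union> {k. k < n \<and> g k \<noteq> f k} = {0..<n}"
    by auto
  ultimately show ?thesis by simp
qed

lemma partial_density_agree:
  assumes "n > 0"
  shows "partial_density n {k. g k = f k} = 1 - real (card {k. k < n \<and> g k \<noteq> f k}) / real n"
proof -
  have "real (card ({k. g k = f k} \<inter> {0..<n})) = real n - real (card {k. k < n \<and> g k \<noteq> f k})"
    using card_agree_disagree[where g = g and f = f and n = n] by linarith
  then show ?thesis
    using assms by (simp add: partial_density_def diff_divide_distrib)
qed

text \<open>Clearing denominators turns the density bound into an inequality of natural numbers,
  which a program can check.\<close>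

lemma eventually_few_disagreements:
  assumes "N > 0" "ereal (1 - 1 / real N) < lower_density {k. g k = f k}"
  shows "\<exists>m. \<forall>n\<ge>m. N * card {k. k < n \<and> g k \<noteq> f k} \<le> n"
proof -
  have "eventually (\<lambda>n. ereal (1 - 1 / real N) < ereal (partial_density n {k. g k = f k})) sequentially"
    using assms(2) unfolding lower_density_def by (rule less_LiminfD)
  then have "eventually (\<lambda>n. N * card {k. k < n \<and> g k \<noteq> f k} \<le> n) sequentially"
    using eventually_gt_at_top[of 0]
  proof eventually_elim
    case (elim n)
    then have "real (card {k. k < n \<and> g k \<noteq> f k}) / real n \<le> 1 / real N"
      by (simp add: partial_density_agree)
    then have "real (N * card {k. k < n \<and> g k \<noteq> f k}) \<le> real n"
      using elim assms(1) by (simp add: field_simps)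
    then show ?case by linarith
  qed
  then show ?thesis by (simp add: eventually_sequentially)
qed

text \<open>After division by \<open>N * n\<close> the additive constant contributes
  \<open>K / (N * n)\<close>, which vanishes in the limit.\<close>

lemma lower_density_agree_ge:
  assumes "N > 0" "\<And>n. N * card {k. k < n \<and> g k \<noteq> f k} \<le> 4 * n + K"
  shows "ereal (1 - 4 / real N) \<le> lower_density {k. g k = f k}"
proof -
  have "((\<lambda>n. 1 - 4 / real N - real K / real N * (1 / real n)) \<longlongrightarrow>
      1 - 4 / real N - real K / real N * 0) sequentially"
    by (intro tendsto_intros lim_1_over_n)
  then have "liminf (\<lambda>n. ereal (1 - 4 / real N - real K / real N * (1 / real n))) = ereal (1 - 4 / real N)"
    by (intro lim_imp_Liminf) (auto intro: tendsto_ereal)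
  moreover have "liminf (\<lambda>n. ereal (1 - 4 / real N - real K / real N * (1 / real n))) \<le>
      lower_density {k. g k = f k}"
    unfolding lower_density_def
  proof (rule Liminf_mono)
    show "eventually (\<lambda>n. ereal (1 - 4 / real N - real K / real N * (1 / real n)) \<le>
        ereal (partial_density n {k. g k = f k})) sequentially"
      using eventually_gt_at_top[of 0]
    proof eventually_elim
      case (elim n)
      have "real (N * card {k. k < n \<and> g k \<noteq> f k}) \<le> real (4 * n + K)"
        using assms(2) of_nat_le_iff by blast
      then have "real (card {k. k < n \<and> g k \<noteq> f k}) / real n \<le>
          4 / real N + real K / real N * (1 / real n)"
        using elim assms(1) by (simp add: field_simps)
      then show ?case
        using elim by (simp add: partial_density_agree)
    qed
  qed
  ultimately show ?thesis by simp
qed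

section \<open>Blocks of approximations\<close>

text \<open>This is the binary length of \<open>k\<close>.\<close>

definition block :: "nat \<Rightarrow> nat" where
  "block k = (LEAST j. k < 2 ^ j)"

lemma less_power_block: "k < 2 ^ block k"
  unfolding block_def by (rule LeastI_ex) (auto intro: less_exp)

lemma block_le: "k < 2 ^ j \<Longrightarrow> block k \<le> j"
  unfolding block_def by (rule Least_le)

lemma rec_fun_block:
  assumes "rec_fun H n A"
  shows "rec_fun H n (\<lambda>xs. block (A xs))"
  unfolding block_def
proof (rule rec_fun_Least)
  have "rec_fun H (Suc n) (\<lambda>ys. A (drop 1 ys))"
    using rec_fun_comp[OF assms] rec_args_drop[OF rec_args_id, of H "Suc n" 1] by simp
  then show "rec_rel H (Suc n) (\<lambda>ys. A (drop 1 ys) < 2 ^ (ys ! 0))"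
    by (intro rec_rel_less rec_fun_power2 rec_fun_nth[OF rec_args_id]) auto
  show "\<exists>j. A xs < 2 ^ j" for xs
    using less_exp by blast
qed

text \<open>By minimality, the next smaller power of 2 is at most \<open>n - 1\<close>.\<close>

lemma power_block_le: "n > 0 \<Longrightarrow> 2 ^ block (n - 1) \<le> 2 * n"
proof (cases "block (n - 1)")
  case (Suc j)
  have "\<not> n - 1 < 2 ^ j"
    using block_le[of "n - 1" j] Suc by auto
  then show ?thesis using Suc by simp
qed auto

text \<open>Below \<open>n\<close> only the blocks up to that of \<open>n - 1\<close> matter. Their allowed errors
  add up to a geometric sum below \<open>4 * n / N\<close>.\<close>

lemma card_disagree_blocks:
  fixes f g :: "nat \<Rightarrow> nat" and v :: "nat \<Rightarrow> nat \<Rightarrow> nat"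
  assumes g: "\<And>k. g k = v (block k) k"
    and v: "\<And>j. m \<le> 2 ^ j \<Longrightarrow> N * card {k. k < 2 ^ j \<and> v j k \<noteq> f k} \<le> 2 ^ j"
  shows "N * card {k. k < n \<and> g k \<noteq> f k} \<le> 4 * n + N * 2 ^ m"
proof (cases "n = 0")
  case False
  define E where "E j = {k. k < 2 ^ j \<and> v j k \<noteq> f k}" for j
  define J where "J = block (n - 1)"
  have finE: "finite (E j)" for j
    by (simp add: E_def)
  \<comment> \<open>If \<open>2 ^ j < m\<close>, nothing is known about \<open>v j\<close> and all
    \<open>2 ^ j\<close> arguments may be wrong; but then \<open>j < m\<close>, so the extra terms
    have a bounded sum.\<close>
  have E: "N * card (E j) \<le> 2 ^ j + (if j < m then N * 2 ^ j else 0)" for j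
  proof (cases "m \<le> 2 ^ j")
    case True
    then show ?thesis using v[of j] by (simp add: E_def)
  next
    case False
    moreover have "j < 2 ^ j" by (rule less_exp)
    ultimately have "j < m" by linarith
    have "card (E j) \<le> card {..<2 ^ j :: nat}"
      by (rule card_mono) (auto simp: E_def)
    then show ?thesis using \<open>j < m\<close> by (simp add: trans_le_add2)
  qed
  \<comment> \<open>An error at \<open>k\<close> is charged to the approximation of its own block,
    whose bound covers all arguments below \<open>2 ^ block k\<close>.\<close>
  have "{k. k < n \<and> g k \<noteq> f k} \<subseteq> (\<Union>j\<le>J. E j)"
  proof
    fix k assume k: "k \<in> {k. k < n \<and> g k \<noteq> f k}"
    then have "k \<le> n - 1" by auto
    also have "\<dots> < 2 ^ J"
      unfolding J_def by (rule less_power_block)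
    finally have "k < 2 ^ J" .
    then have "block k \<le> J" by (rule block_le)
    moreover have "k \<in> E (block k)"
      using k less_power_block[of k] g by (simp add: E_def)
    ultimately show "k \<in> (\<Union>j\<le>J. E j)" by blast
  qed
  then have "card {k. k < n \<and> g k \<noteq> f k} \<le> card (\<Union>j\<le>J. E j)"
    using finE by (intro card_mono) auto
  also have "\<dots> \<le> (\<Sum>j\<le>J. card (E j))"
    by (rule card_UN_le) simp
  finally have "N * card {k. k < n \<and> g k \<noteq> f k} \<le> (\<Sum>j\<le>J. N * card (E j))"
    by (simp add: sum_distrib_left[symmetric])
  also have "\<dots> \<le> (\<Sum>j\<le>J. 2 ^ j + (if j < m then N * 2 ^ j else 0))"
    by (rule sum_mono) (rule E)
  also have "\<dots> = (\<Sum>j\<le>J. 2 ^ j) + (\<Sum>j\<in>{..J} \<inter> {j. j < m}. N * 2 ^ j)"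
    by (simp add: sum.distrib sum.inter_restrict)
  also have "(\<Sum>j\<in>{..J} \<inter> {j. j < m}. N * 2 ^ j) \<le> (\<Sum>j<m. N * 2 ^ j)"
    by (rule sum_mono2) auto
  also have "(\<Sum>j<m. N * 2 ^ j) \<le> N * 2 ^ m"
  proof -
    have "(\<Sum>j<m. 2 ^ j) \<le> (2 ^ m :: nat)"
      by (induction m) auto
    then show ?thesis by (simp add: sum_distrib_left[symmetric])
  qed
  also have "(\<Sum>j\<le>J. 2 ^ j) \<le> (2 * 2 ^ J :: nat)"
    by (induction J) auto
  also have "2 * 2 ^ J \<le> 4 * n"
    using power_block_le[of n] False by (simp add: J_def)
  finally show ?thesis by simp
qed simp

section \<open>The genericity argument\<close>

lemma generic_computable_approximation:
  assumes gen: "one_generic_rel f X"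
    and p: "\<And>k. eval (char_fun X) p [k] (gX k)"
    and few: "\<And>n. m \<le> n \<Longrightarrow> N * card {k. k < n \<and> gX k \<noteq> f k} \<le> n"
  shows "\<exists>g. computable g \<and> (\<forall>n. N * card {k. k < n \<and> g k \<noteq> f k} \<le> 4 * n + N * 2 ^ m)"
proof -
  define conv where "conv s c n \<longleftrightarrow> (\<forall>k<n. approx s (look c) p [k] \<noteq> 0)" for s c n
  \<comment> \<open>Undefined values count as errors too; when \<open>conv\<close> holds, only
    genuine disagreements with \<open>f\<close> remain.\<close>
  define err where "err s c n = card {k. k < n \<and> approx s (look c) p [k] \<noteq> Suc (f k)}" for s c n
  \<comment> \<open>Here \<open>w\<close> codes a length and a stage at which a violation is
    visible. Counting errors queries \<open>f\<close>, hence genericity relative to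
    \<open>f\<close>.\<close>
  define R where "R w c \<longleftrightarrow> m \<le> fst (prod_decode w) \<and>
      conv (snd (prod_decode w)) c (fst (prod_decode w)) \<and>
      fst (prod_decode w) < N * err (snd (prod_decode w)) c (fst (prod_decode w))" for w c
  let ?S = "{\<sigma>. \<exists>w. R w (string_code \<sigma>)}"
  have "rec_rel {f} 2 (\<lambda>xs. R (xs ! 0) (xs ! 1))"
    unfolding R_def conv_def err_def
    by (intro rec_rel_conj rec_rel_le rec_rel_less rec_rel_all_less rec_fun_mult_const rec_fun_card_less
        rec_rel_not rec_rel_eq rec_fun_approx rec_fun_Suc rec_fun_oracle rec_fun_const
        rec_fun_fst_decode rec_fun_snd_decode
        rec_fun_nth[OF rec_args_id] rec_fun_nth[OF rec_args_drop[OF rec_args_id]]) auto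
  then have "ce_in f ?S" by (rule ce_in_ex)
  moreover have "initial_segment X j \<notin> ?S" for j
  proof
    let ?c = "string_code (initial_segment X j)"
    assume "initial_segment X j \<in> ?S"
    then obtain n s where m: "m \<le> n" and conv: "conv s ?c n" and n: "n < N * err s ?c n"
      by (auto simp: R_def)
    \<comment> \<open>Bits of an initial segment of \<open>X\<close> are correct oracle answers, so
      by soundness and determinism the approximations are values of \<open>gX\<close>.\<close>
    have L: "look ?c x = Suc y \<Longrightarrow> char_fun X x = y" for x y
      by (auto simp: look_string_code initial_segment_def char_fun_def split: if_splits)
    have "approx s (look ?c) p [k] = Suc (gX k)" if k: "k < n" for k
    proof -
      obtain y where y: "approx s (look ?c) p [k] = Suc y"
        using conv k unfolding conv_def by (cases "approx s (look ?c) p [k]") auto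
      with eval_det[OF p eval_approx[OF L]] show ?thesis by simp
    qed
    then have "{k. k < n \<and> approx s (look ?c) p [k] \<noteq> Suc (f k)} = {k. k < n \<and> gX k \<noteq> f k}"
      by auto
    with n few[OF m] show False by (simp add: err_def)
  qed
  ultimately obtain n0 where n0: "\<And>\<tau>. prefix (initial_segment X n0) \<tau> \<Longrightarrow> \<tau> \<notin> ?S"
    using gen unfolding one_generic_rel_def by blast
  \<comment> \<open>The constants \<open>n0\<close> and \<open>c0\<close> are all that the program
    for \<open>g\<close> retains of \<open>X\<close>.\<close>
  define c0 where "c0 = string_code (initial_segment X n0)"
  \<comment> \<open>Now \<open>w\<close> codes an oracle string and a stage. Neither
    \<open>f\<close> nor \<open>X\<close> is queried, so the search for \<open>w\<close> needs no
    oracle.\<close>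
  define W where "W w n \<longleftrightarrow> conv (snd (prod_decode w)) (fst (prod_decode w)) n \<and>
      (\<forall>x<n0. look (fst (prod_decode w)) x = look c0 x)" for w n
  \<comment> \<open>Sufficiently long initial segments of \<open>X\<close> itself are
    witnesses.\<close>
  have exW: "\<exists>w. W w n" for n
  proof -
    let ?L = "\<lambda>t x. if x < t then Suc (char_fun X x) else 0"
    have "eventually (\<lambda>t. \<forall>k\<in>{..<n}. approx t (?L t) p [k] = Suc (gX k)) sequentially"
      using p by (intro eventually_ball_finite ballI eventually_approx) auto
    then have "eventually (\<lambda>t. n0 \<le> t \<and> (\<forall>k\<in>{..<n}. approx t (?L t) p [k] = Suc (gX k))) sequentially"
      using eventually_ge_at_top[of n0] by eventually_elim simp
    then obtain t where t: "n0 \<le> t" "\<forall>k\<in>{..<n}. approx t (?L t) p [k] = Suc (gX k)"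
      by (auto simp: eventually_sequentially)
    let ?c = "string_code (initial_segment X t)"
    have "look ?c = ?L t"
      by (auto simp: look_string_code initial_segment_def char_fun_def)
    with t(2) have "conv t ?c n" by (simp add: conv_def)
    moreover have "\<forall>x<n0. look ?c x = look c0 x"
      using t(1) by (auto simp: look_string_code initial_segment_def c0_def)
    ultimately show ?thesis
      by (intro exI[of _ "prod_encode (?c, t)"]) (simp add: W_def)
  qed
  \<comment> \<open>The string found may disagree with \<open>X\<close> beyond \<open>n0\<close>,
    but as an extension of the chosen initial segment it lies outside \<open>?S\<close>. Since it
    converges below \<open>n\<close> and \<open>m \<le> n\<close>, only the error bound can prevent
    \<open>R\<close>.\<close>
  have goodW: "N * err (snd (prod_decode w)) (fst (prod_decode w)) n \<le> n" if "W w n" "m \<le> n" for w n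
  proof -
    obtain c s where w: "prod_decode w = (c, s)" by (cases "prod_decode w")
    let ?\<tau> = "decode_string c"
    have "prefix (initial_segment X n0) ?\<tau>"
      using that(1) by (simp add: prefix_iff_look look_decode_string W_def w c0_def initial_segment_def)
    then have "\<not> R (prod_encode (n, s)) (string_code ?\<tau>)"
      using n0 by blast
    then show ?thesis
      using that by (auto simp: R_def W_def w conv_def err_def look_decode_string not_less)
  qed
  define wit where "wit n = (LEAST w. W w n)" for n
  have wit: "W (wit n) n" for n
    unfolding wit_def by (rule LeastI_ex) (rule exW)
  \<comment> \<open>One witness serves a whole block because only its total error is bounded; a
    separate witness for each argument could err every time.\<close>
  define v where "v j k = approx (snd (prod_decode (wit (2 ^ j)))) (look (fst (prod_decode (wit (2 ^ j))))) p [k] - 1"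
    for j k
  define g where "g k = v (block k) k" for k
  have "rec_fun UNIV 1 (\<lambda>xs. wit (xs ! 0))"
    unfolding wit_def
  proof (rule rec_fun_Least)
    show "rec_rel UNIV (Suc 1) (\<lambda>ys. W (ys ! 0) (drop 1 ys ! 0))"
      unfolding W_def conv_def
      by (intro rec_rel_conj rec_rel_all_less rec_rel_not rec_rel_eq rec_fun_approx rec_fun_look
          rec_fun_const rec_fun_fst_decode rec_fun_snd_decode
          rec_fun_nth[OF rec_args_id] rec_fun_nth[OF rec_args_drop[OF rec_args_id]]
          rec_fun_nth[OF rec_args_drop[OF rec_args_drop[OF rec_args_id]]]) auto
  qed (rule exW)
  from rec_fun_comp[OF this[unfolded One_nat_def] rec_args_single]
  have rec_wit: "rec_fun UNIV n (\<lambda>xs. wit (A xs))" if "rec_fun UNIV n A" for n A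
    using that by simp
  have "rec_fun UNIV 1 (\<lambda>xs. g (xs ! 0))"
    unfolding g_def v_def
    by (intro rec_fun_pred rec_fun_approx rec_fun_fst_decode rec_fun_snd_decode rec_wit rec_fun_power2
        rec_fun_block rec_fun_nth[OF rec_args_id]) auto
  then obtain q where "oracle_free q" "\<And>h xs. length xs = 1 \<Longrightarrow> eval h q xs (g (xs ! 0))"
    unfolding rec_fun_def by blast
  then have "\<And>h k. eval h q [k] (g k)"
    by (metis One_nat_def length_Cons list.size(3) nth_Cons_0)
  with \<open>oracle_free q\<close> have "computable g"
    unfolding computable_def by blast
  moreover have "N * card {k. k < n \<and> g k \<noteq> f k} \<le> 4 * n + N * 2 ^ m" for n
  proof (rule card_disagree_blocks)
    fix j assume j: "m \<le> 2 ^ j"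
    let ?s = "snd (prod_decode (wit (2 ^ j)))" and ?c = "fst (prod_decode (wit (2 ^ j)))"
    have "{k. k < 2 ^ j \<and> v j k \<noteq> f k} \<subseteq> {k. k < 2 ^ j \<and> approx ?s (look ?c) p [k] \<noteq> Suc (f k)}"
      by (auto simp: v_def)
    then have "card {k. k < 2 ^ j \<and> v j k \<noteq> f k} \<le> err ?s ?c (2 ^ j)"
      unfolding err_def by (intro card_mono) auto
    then have "N * card {k. k < 2 ^ j \<and> v j k \<noteq> f k} \<le> N * err ?s ?c (2 ^ j)"
      by (rule mult_le_mono2)
    also have "\<dots> \<le> 2 ^ j" by (rule goodW[OF wit j])
    finally show "N * card {k. k < 2 ^ j \<and> v j k \<noteq> f k} \<le> 2 ^ j" .
  qed (simp add: g_def)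
  ultimately show ?thesis by blast
qed

section \<open>Comparison of the two suprema\<close>

theorem theorem6p10:
  fixes f :: "nat \<Rightarrow> nat" and X :: "nat set"
  assumes "gamma f < 1"
    and "one_generic_rel f X"
  shows "gamma_in X f < 1"
proof -
  \<comment> \<open>With this \<open>N\<close>, an \<open>X\<close>-computable agreement of lower
    density above \<open>1 - 1 / N\<close> would give a computable one of at least
    \<open>1 - 4 / N\<close>, which exceeds \<open>gamma f\<close>.\<close>
  obtain N where N: "0 < N" "4 / real N < 1 - gamma f"
  proof -
    obtain N where N: "4 / (1 - gamma f) < real N"
      using reals_Archimedean2 by blast
    moreover have "0 < 4 / (1 - gamma f)" using assms(1) by simp
    ultimately have "0 < real N" by linarith
    then show ?thesis
      using that[of N] assms(1) N by (simp add: field_simps)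
  qed
  have "gamma_in X f \<le> 1 - 1 / real N"
    unfolding gamma_in_def
  proof (rule cSup_least)
    show "{r. \<exists>g. computable_in (char_fun X) g \<and> ereal r \<le> lower_density {n. g n = f n}} \<noteq> {}"
      using zero_in_gamma_set(2) by blast
  next
    fix r assume "r \<in> {r. \<exists>g. computable_in (char_fun X) g \<and> ereal r \<le> lower_density {n. g n = f n}}"
    then obtain gX p where p: "\<And>k. eval (char_fun X) p [k] (gX k)"
      and r: "ereal r \<le> lower_density {n. gX n = f n}"
      unfolding computable_in_def by blast
    show "r \<le> 1 - 1 / real N"
    proof (rule ccontr)
      assume "\<not> r \<le> 1 - 1 / real N"
      then have "ereal (1 - 1 / real N) < ereal r" by simp
      also note r
      finally obtain m where "\<And>n. m \<le> n \<Longrightarrow> N * card {k. k < n \<and> gX k \<noteq> f k} \<le> n"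
        using eventually_few_disagreements[OF N(1)] by blast
      from generic_computable_approximation[OF assms(2) p this]
      obtain g where g: "computable g" "\<And>n. N * card {k. k < n \<and> g k \<noteq> f k} \<le> 4 * n + N * 2 ^ m"
        by blast
      have "1 - 4 / real N \<le> gamma f"
        unfolding gamma_def
        using g(1) lower_density_agree_ge[OF N(1) g(2)] by (intro cSup_upper gamma_set_bdd) blast
      with N(2) show False by simp
    qed
  qed
  also have "\<dots> < 1" using N(1) by simp
  finally show ?thesis .
qed

end
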